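(* Let $\boldsymbol\alpha_i=(\alpha_{i,1},\ldots,\alpha_{i,k_i})$, $i=1,\ldots,n$, be spherical chains in $\mathbb H$ and let $\overline{\boldsymbol\alpha}_i=(\overline\alpha_{i,1},\ldots,\overline\alpha_{i,k_i})$. Let $V_m^{\boldsymbol\ell}(\boldsymbol\alpha_1,\ldots,\boldsymbol\alpha_n)$ be the left confluent Vandermonde matrix based on the chains $\boldsymbol\alpha_i$ and $V_m^{\boldsymbol r}(\overline{\boldsymbol\alpha}_1,\ldots,\overline{\boldsymbol\alpha}_n)$ the right confluent Vandermonde matrix based on the chains $\overline{\boldsymbol\alpha}_i$. Then $$V_m^{\boldsymbol\ell}(\boldsymbol\alpha_1,\ldots,\boldsymbol\alpha_n)=\big(V_m^{\boldsymbol r}(\overline{\boldsymbol\alpha}_1,\ldots,\overline{\boldsymbol\alpha}_n)\big)^*.$$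
   Context: $\mathbb H$ is the skew field of (real) quaternions, and $M^*$ denotes the conjugate transpose of a quaternion matrix. $\alpha\sim\beta$ means $\alpha=h^{-1}\beta h$ for some nonzero $h\in\mathbb H$. A spherical chain (of length $k$) is a tuple $(\alpha_1,\ldots,\alpha_k)$ with $\alpha_1\sim\cdots\sim\alpha_k$ and $\alpha_{j+1}\neq\overline{\alpha}_j$ for $j=1,\ldots,k-1$. $\mathbb H[z]$ is the polynomial ring in a variable $z$ commuting with quaternion coefficients. For $f(z)=\sum_{j=0}^m z^jf_j$: left and right evaluations are $f^{\boldsymbol{e_\ell}}(\alpha)=\sum\alpha^jf_j$, $f^{\boldsymbol{e_r}}(\alpha)=\sum f_j\alpha^j$; $L_\alpha f$ and $R_\alpha f$ are the unique polynomials with $f=f^{\boldsymbol{e_\ell}}(\alpha)+(z-\alpha)\cdot L_\alpha f=f^{\boldsymbol{e_r}}(\alpha)+R_\alpha f\cdot(z-\alpha)$. Left and right divided differences: $[\alpha_1;f]_{\boldsymbol\ell}=f^{\boldsymbol{e_\ell}}(\alpha_1)$, $[\alpha_1,\ldots,\alpha_j;f]_{\boldsymbol\ell}=(L_{\alpha_{j-1}}\cdots L_{\alpha_1}f)^{\boldsymbol{e_\ell}}(\alpha_j)$ for $j\ge 2$; $[f;\alpha_1]_{\boldsymbol r}=f^{\boldsymbol{e_r}}(\alpha_1)$, $[f;\alpha_1,\ldots,\alpha_j]_{\boldsymbol r}=(R_{\alpha_{j-1}}\cdots R_{\alpha_1}f)^{\boldsymbol{e_r}}(\alpha_j)$ for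 $j\ge 2$. For one chain $\boldsymbol\alpha=(\alpha_1,\ldots,\alpha_k)$, $V_m^{\boldsymbol\ell}(\boldsymbol\alpha)$ is the $k\times m$ matrix with $(i,j)$ entry $[\alpha_1,\ldots,\alpha_i;z^{j-1}]_{\boldsymbol\ell}$, and $V_m^{\boldsymbol r}(\boldsymbol\alpha)$ is the $m\times k$ matrix with $(i,j)$ entry $[z^{i-1};\alpha_1,\ldots,\alpha_j]_{\boldsymbol r}$. $V_m^{\boldsymbol\ell}(\boldsymbol\alpha_1,\ldots,\boldsymbol\alpha_n)$ is obtained by stacking the blocks $V_m^{\boldsymbol\ell}(\boldsymbol\alpha_1),\ldots,V_m^{\boldsymbol\ell}(\boldsymbol\alpha_n)$ vertically, and $V_m^{\boldsymbol r}(\boldsymbol\alpha_1,\ldots,\boldsymbol\alpha_n)=[V_m^{\boldsymbol r}(\boldsymbol\alpha_1)\ \cdots\ V_m^{\boldsymbol r}(\boldsymbol\alpha_n)]$. *)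

theory Defs
  imports Complex_Main "HOL-Library.Poly_Mapping" "Jordan_Normal_Form.Matrix"
begin

section \<open>Quaternions\<close>

datatype quat = Quat (qRe: real) (qI: real) (qJ: real) (qK: real)

lemma quat_eq_iff: "x = y \<longleftrightarrow> qRe x = qRe y \<and> qI x = qI y \<and> qJ x = qJ y \<and> qK x = qK y"
  by (cases x; cases y) auto

instantiation quat :: division_ring
begin

definition "0 = Quat 0 0 0 0"
definition "1 = Quat 1 0 0 0"
definition "x + y = Quat (qRe x + qRe y) (qI x + qI y) (qJ x + qJ y) (qK x + qK y)"
definition "- x = Quat (- qRe x) (- qI x) (- qJ x) (- qK x)"
definition "x - y = Quat (qRe x - qRe y) (qI x - qI y) (qJ x - qJ y) (qK x - qK y)"
definition "x * y = Quat
  (qRe x * qRe y - qI x * qI y - qJ x * qJ y - qK x * qK y)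
  (qRe x * qI y + qI x * qRe y + qJ x * qK y - qK x * qJ y)
  (qRe x * qJ y - qI x * qK y + qJ x * qRe y + qK x * qI y)
  (qRe x * qK y + qI x * qJ y - qJ x * qI y + qK x * qRe y)"
definition "inverse x = (let n = (qRe x)^2 + (qI x)^2 + (qJ x)^2 + (qK x)^2 in
  Quat (qRe x / n) (- qI x / n) (- qJ x / n) (- qK x / n))"
definition "x div y = x * inverse (y :: quat)"

lemmas quat_defs = zero_quat_def one_quat_def plus_quat_def uminus_quat_def minus_quat_def
  times_quat_def

lemma quat_norm_nonzero:
  assumes "x \<noteq> 0"
  shows "(qRe x)^2 + (qI x)^2 + (qJ x)^2 + (qK x)^2 \<noteq> 0"
proof
  assume "(qRe x)^2 + (qI x)^2 + (qJ x)^2 + (qK x)^2 = 0"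
  hence "(qRe x)^2 = 0 \<and> (qI x)^2 = 0 \<and> (qJ x)^2 = 0 \<and> (qK x)^2 = 0"
    using zero_le_power2[of "qRe x"] zero_le_power2[of "qI x"]
      zero_le_power2[of "qJ x"] zero_le_power2[of "qK x"] by linarith
  with assms show False by (simp add: quat_eq_iff quat_defs)
qed

instance
proof
  fix x y z :: quat
  show "x * y * z = x * (y * z)"
    by (simp add: quat_eq_iff quat_defs) (simp add: algebra_simps)
  show "(x + y) * z = x * z + y * z" "x * (y + z) = x * y + x * z"
    by (simp_all add: quat_eq_iff quat_defs algebra_simps)
  show "inverse x * x = 1" "x * inverse x = 1" if "x \<noteq> 0"
    using quat_norm_nonzero[OF that]
    by (simp_all add: quat_eq_iff quat_defs inverse_quat_def Let_def power2_eq_square)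
      (simp_all flip: add_divide_distrib)
  show "x div y = x * inverse y" by (simp add: divide_quat_def)
qed (simp_all add: quat_eq_iff quat_defs inverse_quat_def)

end

definition qcnj :: "quat \<Rightarrow> quat" where
  "qcnj x = Quat (qRe x) (- qI x) (- qJ x) (- qK x)"

definition qsim :: "quat \<Rightarrow> quat \<Rightarrow> bool"  (infix \<open>\<sim>\<^sub>q\<close> 50) where
  "a \<sim>\<^sub>q b \<longleftrightarrow> (\<exists>h. h \<noteq> 0 \<and> a = inverse h * b * h)"

definition spherical_chain :: "quat list \<Rightarrow> bool" where
  "spherical_chain as \<longleftrightarrow> as \<noteq> [] \<and>
     (\<forall>j. Suc j < length as \<longrightarrow> as ! j \<sim>\<^sub>q as ! Suc j \<and> as ! Suc j \<noteq> qcnj (as ! j))"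


section \<open>Polynomials in a central variable\<close>

text \<open>The multiplication of \<^typ>\<open>nat \<Rightarrow>\<^sub>0 quat\<close> is convolution, with the order of the
  coefficients respected, so this is the polynomial ring over the quaternions in a variable that
  commutes with the coefficients. (The multiplication of type \<open>poly\<close> is only
  available over commutative coefficients.)\<close>

type_synonym qpoly = "nat \<Rightarrow>\<^sub>0 quat"

definition qconst :: "quat \<Rightarrow> qpoly" where
  "qconst c = Poly_Mapping.single 0 c"

definition qZ :: qpoly where
  "qZ = Poly_Mapping.single 1 1"

definition eval_left :: "qpoly \<Rightarrow> quat \<Rightarrow> quat" where
  "eval_left f a = (\<Sum>j\<in>Poly_Mapping.keys f. a ^ j * Poly_Mapping.lookup f j)"

definition eval_right :: "qpoly \<Rightarrow> quat \<Rightarrow> quat" where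
  "eval_right f a = (\<Sum>j\<in>Poly_Mapping.keys f. Poly_Mapping.lookup f j * a ^ j)"

definition quot_left :: "quat \<Rightarrow> qpoly \<Rightarrow> qpoly" where
  "quot_left a f = (THE g. f = qconst (eval_left f a) + (qZ - qconst a) * g)"

definition quot_right :: "quat \<Rightarrow> qpoly \<Rightarrow> qpoly" where
  "quot_right a f = (THE g. f = qconst (eval_right f a) + g * (qZ - qconst a))"

lemma qpoly_central_form:
  "f = (\<Sum>j\<in>Poly_Mapping.keys f. qZ ^ j * qconst (Poly_Mapping.lookup f j))"
  "f = (\<Sum>j\<in>Poly_Mapping.keys f. qconst (Poly_Mapping.lookup f j) * qZ ^ j)"
proof -
  have Z: "qZ ^ j = Poly_Mapping.single j 1" for j
    by (induction j) (simp_all add: qZ_def mult_single)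
  have "f = (\<Sum>j\<in>Poly_Mapping.keys f. Poly_Mapping.single j (Poly_Mapping.lookup f j))"
    by (rule poly_mapping_eqI)
      (auto simp: lookup_sum lookup_single when_def in_keys_iff sum.delta)
  thus "f = (\<Sum>j\<in>Poly_Mapping.keys f. qZ ^ j * qconst (Poly_Mapping.lookup f j))"
    "f = (\<Sum>j\<in>Poly_Mapping.keys f. qconst (Poly_Mapping.lookup f j) * qZ ^ j)"
    by (simp_all add: Z qconst_def mult_single)
qed

lemma qconst_hom:
  "qconst (a + b) = qconst a + qconst b" "qconst (a * b) = qconst a * qconst b"
  "qconst 0 = 0" "qconst 1 = 1" "qconst (sum h A) = (\<Sum>x\<in>A. qconst (h x))"
  "qconst (a ^ n) = qconst a ^ n"
proof -
  show 1: "qconst (a + b) = qconst a + qconst b" "qconst 0 = 0" for a b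
    by (simp_all add: qconst_def single_add)
  show 2: "qconst (a * b) = qconst a * qconst b" "qconst 1 = 1" for a b
    by (simp_all add: qconst_def mult_single)
  show "qconst (sum h A) = (\<Sum>x\<in>A. qconst (h x))"
    by (induction A rule: infinite_finite_induct) (simp_all add: 1)
  show "qconst (a ^ n) = qconst a ^ n"
    by (induction n) (simp_all add: 2)
qed

lemma qZ_commute: "qZ * qconst c = qconst c * qZ"
  by (simp add: qZ_def qconst_def mult_single)

lemma qZ_minus_qconst_nonzero: "qZ - qconst a \<noteq> 0"
proof
  assume "qZ - qconst a = 0"
  hence "Poly_Mapping.lookup (qZ - qconst a) 1 = 0" by simp
  thus False by (simp add: qZ_def qconst_def lookup_minus lookup_single when_def)
qed

lemma qZ_power_diff:
  "\<exists>g. qZ ^ j - qconst a ^ j = (qZ - qconst a) * g \<and> qZ ^ j - qconst a ^ j = g * (qZ - qconst a)"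
proof (induction j)
  case (Suc j)
  then obtain g where g: "qZ ^ j - qconst a ^ j = (qZ - qconst a) * g"
    "qZ ^ j - qconst a ^ j = g * (qZ - qconst a)" by blast
  have Zj: "qZ ^ j * qconst a = qconst a * qZ ^ j"
    by (rule power_commuting_commutes[OF qZ_commute])
  have 1: "qZ ^ Suc j - qconst a ^ Suc j = (qZ - qconst a) * qZ ^ j + (qZ ^ j - qconst a ^ j) * qconst a"
    by (simp add: algebra_simps Zj power_commutes)
  have 2: "qZ ^ Suc j - qconst a ^ Suc j = qZ ^ j * (qZ - qconst a) + (qZ ^ j - qconst a ^ j) * qconst a"
    by (simp add: algebra_simps power_commutes)
  have 3: "(qZ - qconst a) * qconst a = qconst a * (qZ - qconst a)"
    by (simp add: algebra_simps qZ_commute)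
  have "qZ ^ Suc j - qconst a ^ Suc j = (qZ - qconst a) * (qZ ^ j + g * qconst a)"
    unfolding 1 g(1) by (simp add: distrib_left mult.assoc)
  moreover have "qZ ^ Suc j - qconst a ^ Suc j = (qZ ^ j + g * qconst a) * (qZ - qconst a)"
    unfolding 2 g(2) by (simp add: distrib_right mult.assoc 3)
  ultimately show ?case by blast
qed (auto intro!: exI[of _ 0])

lemma quot_left_ex1: "\<exists>!g. f = qconst (eval_left f a) + (qZ - qconst a) * g"
proof -
  have "\<forall>j. \<exists>g. qZ ^ j - qconst a ^ j = (qZ - qconst a) * g"
    using qZ_power_diff by blast
  from choice[OF this] obtain G where G: "\<And>j. qZ ^ j - qconst a ^ j = (qZ - qconst a) * G j"
    by blast
  have "f - qconst (eval_left f a) =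
      (\<Sum>j\<in>Poly_Mapping.keys f. (qZ ^ j - qconst a ^ j) * qconst (Poly_Mapping.lookup f j))"
    by (subst (1) qpoly_central_form(1))
      (simp add: eval_left_def qconst_hom sum_subtractf left_diff_distrib)
  also have "\<dots> = (qZ - qconst a) * (\<Sum>j\<in>Poly_Mapping.keys f. G j * qconst (Poly_Mapping.lookup f j))"
    by (simp add: G sum_distrib_left mult.assoc)
  finally have "\<exists>g. f - qconst (eval_left f a) = (qZ - qconst a) * g" by blast
  then obtain g where g: "f = qconst (eval_left f a) + (qZ - qconst a) * g"
    by (metis add.commute diff_add_cancel)
  show ?thesis
  proof (rule ex1I)
    fix h assume "f = qconst (eval_left f a) + (qZ - qconst a) * h"
    with g have "(qZ - qconst a) * h = (qZ - qconst a) * g" by (metis add_left_cancel)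
    thus "h = g" using qZ_minus_qconst_nonzero by simp
  qed (fact g)
qed

lemma quot_right_ex1: "\<exists>!g. f = qconst (eval_right f a) + g * (qZ - qconst a)"
proof -
  have "\<forall>j. \<exists>g. qZ ^ j - qconst a ^ j = g * (qZ - qconst a)"
    using qZ_power_diff by blast
  from choice[OF this] obtain G where G: "\<And>j. qZ ^ j - qconst a ^ j = G j * (qZ - qconst a)"
    by blast
  have "f - qconst (eval_right f a) =
      (\<Sum>j\<in>Poly_Mapping.keys f. qconst (Poly_Mapping.lookup f j) * (qZ ^ j - qconst a ^ j))"
    by (subst (1) qpoly_central_form(2))
      (simp add: eval_right_def qconst_hom sum_subtractf right_diff_distrib)
  also have "\<dots> = (\<Sum>j\<in>Poly_Mapping.keys f. qconst (Poly_Mapping.lookup f j) * G j) * (qZ - qconst a)"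
    by (simp add: G sum_distrib_right mult.assoc)
  finally have "\<exists>g. f - qconst (eval_right f a) = g * (qZ - qconst a)" by blast
  then obtain g where g: "f = qconst (eval_right f a) + g * (qZ - qconst a)"
    by (metis add.commute diff_add_cancel)
  show ?thesis
  proof (rule ex1I)
    fix h assume "f = qconst (eval_right f a) + h * (qZ - qconst a)"
    with g have "h * (qZ - qconst a) = g * (qZ - qconst a)" by (metis add_left_cancel)
    thus "h = g" using qZ_minus_qconst_nonzero by simp
  qed (fact g)
qed


section \<open>Divided differences\<close>

text \<open>\<^term>\<open>fold\<close> applies the quotient operator of the first chain element first. Both
  functions are meaningful for nonempty lists only.\<close>

definition divdiff_left :: "quat list \<Rightarrow> qpoly \<Rightarrow> quat" where
  "divdiff_left as f = eval_left (fold quot_left (butlast as) f) (last as)"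

definition divdiff_right :: "qpoly \<Rightarrow> quat list \<Rightarrow> quat" where
  "divdiff_right f as = eval_right (fold quot_right (butlast as) f) (last as)"


section \<open>Confluent Vandermonde matrices\<close>

text \<open>Matrix indices start at 0: row (column) \<open>i\<close> of a block uses the first \<open>i + 1\<close> elements
  of its chain, and powers run from \<open>0\<close> to \<open>m - 1\<close>.\<close>

definition vandermonde_left_block :: "nat \<Rightarrow> quat list \<Rightarrow> quat mat" where
  "vandermonde_left_block m as =
     mat (length as) m (\<lambda>(i, j). divdiff_left (take (Suc i) as) (qZ ^ j))"

definition vandermonde_right_block :: "nat \<Rightarrow> quat list \<Rightarrow> quat mat" where
  "vandermonde_right_block m as =
     mat m (length as) (\<lambda>(i, j). divdiff_right (qZ ^ i) (take (Suc j) as))"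

definition append_columns :: "quat mat \<Rightarrow> quat mat \<Rightarrow> quat mat" where
  "append_columns A B = four_block_mat A B (0\<^sub>m 0 (dim_col A)) (0\<^sub>m 0 (dim_col B))"

definition vandermonde_left :: "nat \<Rightarrow> quat list list \<Rightarrow> quat mat" where
  "vandermonde_left m ass = foldr (@\<^sub>r) (map (vandermonde_left_block m) ass) (0\<^sub>m 0 m)"

definition vandermonde_right :: "nat \<Rightarrow> quat list list \<Rightarrow> quat mat" where
  "vandermonde_right m ass = foldr append_columns (map (vandermonde_right_block m) ass) (0\<^sub>m m 0)"

definition conjugate_transpose :: "quat mat \<Rightarrow> quat mat" where
  "conjugate_transpose A = map_mat qcnj (transpose_mat A)"

end

theory Submission
  imports Defs
begin

text \<open>Conjugating the coefficients is an additive anti-automorphism of \<open>\<H>[z]\<close> fixing \<open>z\<close>. It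
  therefore turns the division \<open>f = f(\<alpha>) + (z - \<alpha>) L\<^sub>\<alpha>f\<close> into the right division of the
  conjugate polynomial at the conjugate point, hence exchanges left and right divided
  differences. The entries of the two matrices correspond because every \<open>z ^ j\<close> is its own
  conjugate.\<close>

lemma qcnj_hom:
  "qcnj 0 = 0" "qcnj 1 = 1" "qcnj (x + y) = qcnj x + qcnj y" "qcnj (x - y) = qcnj x - qcnj y"
  "qcnj (x * y) = qcnj y * qcnj x"
  by (simp_all add: qcnj_def quat_defs algebra_simps)

lemma qcnj_qcnj [simp]: "qcnj (qcnj x) = x"
  by (simp add: qcnj_def)

lemma qcnj_eq_0_iff [simp]: "qcnj x = 0 \<longleftrightarrow> x = 0"
  by (metis qcnj_hom(1) qcnj_qcnj)

lemma qcnj_power: "qcnj (x ^ n) = qcnj x ^ n"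
  by (induction n) (simp_all add: qcnj_hom power_commutes)

lemma qcnj_sum: "qcnj (sum h A) = (\<Sum>x\<in>A. qcnj (h x))"
  by (induction A rule: infinite_finite_induct) (simp_all add: qcnj_hom)


definition poly_cnj :: "qpoly \<Rightarrow> qpoly" where
  "poly_cnj f = Poly_Mapping.map qcnj f"

lemma lookup_poly_cnj: "Poly_Mapping.lookup (poly_cnj f) k = qcnj (Poly_Mapping.lookup f k)"
  by (simp add: poly_cnj_def map.rep_eq when_def qcnj_hom)

lemma keys_poly_cnj: "Poly_Mapping.keys (poly_cnj f) = Poly_Mapping.keys f"
  by (auto simp: in_keys_iff lookup_poly_cnj)

lemma poly_cnj_add: "poly_cnj (f + g) = poly_cnj f + poly_cnj g"
  by (rule poly_mapping_eqI) (simp add: lookup_poly_cnj lookup_add qcnj_hom)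

lemma poly_cnj_diff: "poly_cnj (f - g) = poly_cnj f - poly_cnj g"
  by (rule poly_mapping_eqI) (simp add: lookup_poly_cnj lookup_minus qcnj_hom)

lemma poly_cnj_single: "poly_cnj (Poly_Mapping.single k c) = Poly_Mapping.single k (qcnj c)"
  by (rule poly_mapping_eqI) (simp add: lookup_poly_cnj lookup_single when_def qcnj_hom)

lemma poly_cnj_sum: "poly_cnj (sum h A) = (\<Sum>x\<in>A. poly_cnj (h x))"
  by (induction A rule: infinite_finite_induct)
    (simp_all add: poly_cnj_add poly_mapping_eqI lookup_poly_cnj qcnj_hom)

lemma poly_cnj_qconst: "poly_cnj (qconst c) = qconst (qcnj c)"
  by (simp add: qconst_def poly_cnj_single)

lemma poly_cnj_qZ_power: "poly_cnj (qZ ^ j) = qZ ^ j"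
proof -
  have "qZ ^ j = Poly_Mapping.single j 1"
    by (induction j) (simp_all add: qZ_def mult_single)
  then show ?thesis
    by (simp add: poly_cnj_single qcnj_hom)
qed

text \<open>By additivity it suffices to treat monomials: \<open>qcnj\<close> reverses the product
  of the coefficients, while the exponents add commutatively.\<close>

lemma poly_cnj_mult: "poly_cnj (f * g) = poly_cnj g * poly_cnj f"
proof -
  have sum_singles: "f = (\<Sum>j\<in>Poly_Mapping.keys f. Poly_Mapping.single j (Poly_Mapping.lookup f j))"
    for f :: qpoly
    by (rule poly_mapping_eqI)
      (auto simp: lookup_sum lookup_single when_def in_keys_iff sum.delta)
  let ?S = "\<lambda>f j. Poly_Mapping.single j (Poly_Mapping.lookup f j) :: qpoly"
  have "poly_cnj (sum (?S f) A * sum (?S g) B) = poly_cnj (sum (?S g) B) * poly_cnj (sum (?S f) A)"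
    for A B
    unfolding sum_product poly_cnj_sum
    \<comment> \<open>Reversing the factors also reverses the nesting of the double sum.\<close>
    by (subst sum.swap) (simp add: poly_cnj_single mult_single qcnj_hom add.commute)
  then show ?thesis
    using sum_singles by metis
qed

lemma qcnj_eval_left: "qcnj (eval_left f a) = eval_right (poly_cnj f) (qcnj a)"
  by (simp add: eval_left_def eval_right_def qcnj_sum qcnj_hom qcnj_power lookup_poly_cnj
    keys_poly_cnj)

text \<open>The conjugate of the equation defining the left quotient is the equation that determines
  the right quotient uniquely.\<close>

lemma poly_cnj_quot_left: "poly_cnj (quot_left a f) = quot_right (qcnj a) (poly_cnj f)"
proof -
  have "f = qconst (eval_left f a) + (qZ - qconst a) * quot_left a f"
    unfolding quot_left_def by (rule theI'[OF quot_left_ex1])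
  then have "poly_cnj f =
      poly_cnj (qconst (eval_left f a) + (qZ - qconst a) * quot_left a f)"
    by (rule arg_cong)
  also have "\<dots> = qconst (eval_right (poly_cnj f) (qcnj a)) +
      poly_cnj (quot_left a f) * (qZ - qconst (qcnj a))"
    \<comment> \<open>The case of exponent 1 says that the variable itself is fixed.\<close>
    using poly_cnj_qZ_power[of 1]
    by (simp add: poly_cnj_add poly_cnj_mult poly_cnj_diff poly_cnj_qconst qcnj_eval_left)
  finally show ?thesis
    unfolding quot_right_def by (rule the1_equality[OF quot_right_ex1, symmetric])
qed

lemma poly_cnj_fold_quot_left:
  "poly_cnj (fold quot_left as f) = fold quot_right (map qcnj as) (poly_cnj f)"
  by (induction as arbitrary: f) (simp_all add: poly_cnj_quot_left)

text \<open>Nonemptiness lets \<open>last\<close> commute with \<open>map qcnj\<close>.\<close>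

lemma qcnj_divdiff_left:
  assumes "as \<noteq> []"
  shows "qcnj (divdiff_left as f) = divdiff_right (poly_cnj f) (map qcnj as)"
  using assms
  by (simp add: divdiff_left_def divdiff_right_def qcnj_eval_left poly_cnj_fold_quot_left
    map_butlast last_map)

lemma vandermonde_left_block_eq_conjugate_transpose:
  "vandermonde_left_block m as = conjugate_transpose (vandermonde_right_block m (map qcnj as))"
proof (rule eq_matI)
  fix i j
  assume "i < dim_row (conjugate_transpose (vandermonde_right_block m (map qcnj as)))"
    and "j < dim_col (conjugate_transpose (vandermonde_right_block m (map qcnj as)))"
  then have "i < length as" and "j < m"
    by (simp_all add: conjugate_transpose_def vandermonde_right_block_def)
  \<comment> \<open>Row \<open>i\<close> uses \<open>i + 1\<close> chain elements, so its prefix is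
    never empty.\<close>
  moreover from this have "take (Suc i) as \<noteq> []"
    by auto
  then have "divdiff_right (qZ ^ j) (map qcnj (take (Suc i) as)) =
      qcnj (divdiff_left (take (Suc i) as) (qZ ^ j))"
    by (metis qcnj_divdiff_left poly_cnj_qZ_power)
  ultimately show "vandermonde_left_block m as $$ (i, j) =
      conjugate_transpose (vandermonde_right_block m (map qcnj as)) $$ (i, j)"
    by (simp add: conjugate_transpose_def vandermonde_left_block_def vandermonde_right_block_def
      take_map)
qed (simp_all add: conjugate_transpose_def vandermonde_left_block_def vandermonde_right_block_def)

text \<open>Equal heights keep the row indices of \<open>A\<close> within the range of
  \<open>B\<close>.\<close>

lemma conjugate_transpose_append_columns:
  assumes "dim_row A = dim_row B"
  shows "conjugate_transpose (append_columns A B) =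
    conjugate_transpose A @\<^sub>r conjugate_transpose B"
  by (rule eq_matI) (use assms in
    \<open>auto simp: conjugate_transpose_def append_columns_def append_rows_def Let_def\<close>)

text \<open>The height of the joined matrix is that of its first block, so a case split replaces
  induction.\<close>

lemma dim_row_vandermonde_right: "dim_row (vandermonde_right m ass) = m"
  by (cases ass) (simp_all add: vandermonde_right_def append_columns_def vandermonde_right_block_def)

theorem lemma1p6:
  fixes m :: nat and \<alpha>s :: "quat list list"
  assumes "\<And>\<alpha>. \<alpha> \<in> set \<alpha>s \<Longrightarrow> spherical_chain \<alpha>"
  shows "vandermonde_left m \<alpha>s =
    conjugate_transpose (vandermonde_right m (map (map qcnj) \<alpha>s))"
proof (induction \<alpha>s)
  case Nil
  \<comment> \<open>Both sides are the 0 by \<open>m\<close> matrix, so there are no entries to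
    compare.\<close>
  show ?case
    by (rule eq_matI)
      (simp_all add: vandermonde_left_def vandermonde_right_def conjugate_transpose_def)
next
  case (Cons \<alpha> \<alpha>s)
  let ?R = "vandermonde_right m (map (map qcnj) \<alpha>s)"
  have "vandermonde_left m (\<alpha> # \<alpha>s) = vandermonde_left_block m \<alpha> @\<^sub>r vandermonde_left m \<alpha>s"
    by (simp add: vandermonde_left_def)
  also have "\<dots> = conjugate_transpose
      (append_columns (vandermonde_right_block m (map qcnj \<alpha>)) ?R)"
    by (simp add: Cons.IH vandermonde_left_block_eq_conjugate_transpose
      conjugate_transpose_append_columns dim_row_vandermonde_right)
      \<comment> \<open>Unfolding the block exposes its height \<open>m\<close>, which discharges
        the equal-height condition.\<close>
      (simp add: vandermonde_right_block_def conjugate_transpose_append_columns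
      dim_row_vandermonde_right)
  also have "\<dots> = conjugate_transpose (vandermonde_right m (map (map qcnj) (\<alpha> # \<alpha>s)))"
    by (simp add: vandermonde_right_def)
  finally show ?case .
qed

end
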